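(* The algebras $B_q^{res1}(2)$ and $B_q^{res2}(2)$ are two integral forms of the $q$-boson algebra $B_q(2)$; that is, each of $\tilde B=B_q^{res1}(2)$ and $\tilde B=B_q^{res2}(2)$ is a $\mathbb{C}[q,q^{-1}]$-subalgebra of $B_q(2)$ with $B_q(2)=\tilde B\otimes_{\mathbb{C}[q,q^{-1}]}\mathbb{C}(q)$ (via the natural multiplication map).
   Context: Let $q$ be an indeterminate, $\mathcal{A}=\mathbb{C}[q,q^{-1}]$, $\mathbb{N}=\{1,2,\dots\}$, $[n]_q=\frac{q^n-q^{-n}}{q-q^{-1}}$, $[m]_q!=[m]_q\cdots[1]_q$. The $q$-boson algebra $B_q(2)$ of rank 2 is the unital associative $\mathbb{C}(q)$-algebra generated by $a_i,a_i^+,K_i^{\pm1}$ ($i=1,2$) with relations $a_ia_i^+-q^2a_i^+a_i=1$; $[a_i,a_j^+]=0$ for $i\ne j$; $[a_i,a_j]=[a_i^+,a_j^+]=0$; $K_ia_j^+K_i^{-1}=q^{\delta_{ij}}a_j^+$; $K_ia_jK_i^{-1}=q^{-\delta_{ij}}a_j$; $K_iK_i^{-1}=K_i^{-1}K_i=1$; $K_1K_2=K_2K_1$. Put $a_i^{(n)}=a_i^n/[n]_q!$ and $a_i^{+(n)}=(a_i^+)^n/[n]_q!$. $B_q^{res1}(2)$ is the $\mathcal{A}$-subalgebra of $B_q(2)$ generated by $a_i,a_i^{+(r)},K_i^{\pm1},1$ ($i=1,2$; $r\in\mathbb{N}$). $B_q^{res2}(2)$ is the $\mathcal{A}$-subalgebra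 of $B_q(2)$ generated by $a_1,a_1^{+(r)},a_2^{(r)},a_2^+,K_1^{\pm1},K_2^{\pm1},1$ ($r\in\mathbb{N}$). *)

theory Defs
  imports
    "HOL-Library.Poly_Mapping"
    "HOL-Computational_Algebra.Computational_Algebra"
    "HOL-Algebra.QuotRing"
    "HOL-Algebra.Generated_Groups"
begin

section \<open>The ground rings\<close>

type_synonym Cq = "complex poly fract"

definition qq :: Cq where
  "qq = to_fract [:0, 1:]"

text \<open>The subring \<open>\<complex>[q, q\<^sup>-\<^sup>1]\<close> of \<open>\<complex>(q)\<close>.\<close>

definition laurent :: "Cq set" where
  "laurent = {to_fract p / qq ^ n | p n. True}"

definition qint :: "nat \<Rightarrow> Cq" where
  "qint n = (qq ^ n - inverse qq ^ n) / (qq - inverse qq)"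

definition qfact :: "nat \<Rightarrow> Cq" where
  "qfact m = (\<Prod>k = 1..m. qint k)"

section \<open>The free algebra on the generators\<close>

datatype idx = I1 | I2

datatype gen = GA idx | GAp idx | GK idx | GKinv idx

text \<open>
  Words under concatenation. The monoid is written additively because \<open>poly_mapping\<close> forms the
  monoid algebra of an additively written (not necessarily commutative) monoid; with it,
  \<open>gen word \<Rightarrow>\<^sub>0 Cq\<close> with its library multiplication is the free associative unital
  \<open>\<complex>(q)\<close>-algebra on \<open>gen\<close>.
\<close>

datatype 'g word = Word "'g list"

instantiation word :: (type) monoid_add
begin

definition zero_word :: "'a word" where
  "0 = Word []"

fun plus_word :: "'a word \<Rightarrow> 'a word \<Rightarrow> 'a word" where
  "Word u + Word v = Word (u @ v)"

instance
proof
  fix a b c :: "'a word"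
  show "a + b + c = a + (b + c)" by (cases a; cases b; cases c) simp
  show "0 + a = a" by (cases a) (simp add: zero_word_def)
  show "a + 0 = a" by (cases a) (simp add: zero_word_def)
qed

end

type_synonym free_alg = "gen word \<Rightarrow>\<^sub>0 Cq"

definition gvar :: "gen \<Rightarrow> free_alg" where
  "gvar g = Poly_Mapping.single (Word [g]) 1"

definition fconst :: "Cq \<Rightarrow> free_alg" where
  "fconst c = Poly_Mapping.single 0 c"

section \<open>The \<open>q\<close>-boson algebra of rank 2\<close>

definition delta :: "idx \<Rightarrow> idx \<Rightarrow> nat" where
  "delta i j = (if i = j then 1 else 0)"

text \<open>Each relation \<open>l = r\<close> is represented by \<open>l - r\<close>.\<close>

inductive_set relators :: "free_alg set" where
  boson: "gvar (GA i) * gvar (GAp i) - fconst (qq\<^sup>2) * gvar (GAp i) * gvar (GA i) - 1 \<in> relators"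
| comm_A_Ap: "i \<noteq> j \<Longrightarrow> gvar (GA i) * gvar (GAp j) - gvar (GAp j) * gvar (GA i) \<in> relators"
| comm_A: "gvar (GA i) * gvar (GA j) - gvar (GA j) * gvar (GA i) \<in> relators"
| comm_Ap: "gvar (GAp i) * gvar (GAp j) - gvar (GAp j) * gvar (GAp i) \<in> relators"
| K_Ap: "gvar (GK i) * gvar (GAp j) * gvar (GKinv i) - fconst (qq ^ delta i j) * gvar (GAp j) \<in> relators"
| K_A: "gvar (GK i) * gvar (GA j) * gvar (GKinv i) - fconst (inverse qq ^ delta i j) * gvar (GA j) \<in> relators"
| K_Kinv: "gvar (GK i) * gvar (GKinv i) - 1 \<in> relators"
| Kinv_K: "gvar (GKinv i) * gvar (GK i) - 1 \<in> relators"
| comm_K: "gvar (GK I1) * gvar (GK I2) - gvar (GK I2) * gvar (GK I1) \<in> relators"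

inductive_set rel_ideal :: "free_alg set" where
  zero: "0 \<in> rel_ideal"
| incl: "r \<in> relators \<Longrightarrow> u * r * v \<in> rel_ideal"
| add: "x \<in> rel_ideal \<Longrightarrow> y \<in> rel_ideal \<Longrightarrow> x + y \<in> rel_ideal"

lemma rel_ideal_mult_left: "x \<in> rel_ideal \<Longrightarrow> w * x \<in> rel_ideal"
proof (induction rule: rel_ideal.induct)
  case (incl r u v)
  then show ?case using rel_ideal.incl[of r "w * u" v] by (simp add: mult.assoc)
qed (simp_all add: rel_ideal.zero rel_ideal.add distrib_left)

lemma rel_ideal_mult_right: "x \<in> rel_ideal \<Longrightarrow> x * w \<in> rel_ideal"
proof (induction rule: rel_ideal.induct)
  case (incl r u v)
  then show ?case using rel_ideal.incl[of r u "v * w"] by (simp add: mult.assoc)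
qed (simp_all add: rel_ideal.zero rel_ideal.add distrib_right)

lemma rel_ideal_uminus: "x \<in> rel_ideal \<Longrightarrow> - x \<in> rel_ideal"
  using rel_ideal_mult_left[of x "- 1"] by simp

definition rel_cong :: "free_alg \<Rightarrow> free_alg \<Rightarrow> bool" where
  "rel_cong x y \<longleftrightarrow> x - y \<in> rel_ideal"

lemma equivp_rel_cong: "equivp rel_cong"
proof (rule equivpI)
  show "reflp rel_cong"
    by (simp add: reflp_def rel_cong_def rel_ideal.zero)
  show "symp rel_cong"
    unfolding symp_def rel_cong_def by (metis minus_diff_eq rel_ideal_uminus)
  show "transp rel_cong"
    unfolding transp_def rel_cong_def
    by (metis (no_types, opaque_lifting) add_diff_eq diff_add_cancel rel_ideal.add)
qed

quotient_type qboson = free_alg / rel_cong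
  by (rule equivp_rel_cong)

instantiation qboson :: "{ring, monoid_mult}"
begin

lift_definition zero_qboson :: qboson is 0 .

lift_definition one_qboson :: qboson is 1 .

lift_definition plus_qboson :: "qboson \<Rightarrow> qboson \<Rightarrow> qboson" is "(+)"
  unfolding rel_cong_def by (metis add_diff_add rel_ideal.add)

lift_definition uminus_qboson :: "qboson \<Rightarrow> qboson" is uminus
  unfolding rel_cong_def by (metis minus_diff_minus rel_ideal_uminus)

lift_definition minus_qboson :: "qboson \<Rightarrow> qboson \<Rightarrow> qboson" is "(-)"
  unfolding rel_cong_def
  by (metis (no_types, opaque_lifting) add_diff_add diff_conv_add_uminus minus_diff_minus
      rel_ideal.add rel_ideal_uminus)

lift_definition times_qboson :: "qboson \<Rightarrow> qboson \<Rightarrow> qboson" is "(*)"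
proof -
  fix x x' y y' :: free_alg
  assume "rel_cong x x'" "rel_cong y y'"
  then have "(x - x') * y + x' * (y - y') \<in> rel_ideal"
    unfolding rel_cong_def
    by (intro rel_ideal.add rel_ideal_mult_left rel_ideal_mult_right)
  then show "rel_cong (x * y) (x' * y')"
    by (simp add: rel_cong_def algebra_simps)
qed

instance
proof intro_classes
  fix a b c :: qboson
  show "a + b + c = a + (b + c)" by transfer (simp add: rel_cong_def rel_ideal.zero add.assoc)
  show "a + b = b + a" by transfer (simp add: rel_cong_def rel_ideal.zero add.commute)
  show "0 + a = a" by transfer (simp add: rel_cong_def rel_ideal.zero)
  show "- a + a = 0" by transfer (simp add: rel_cong_def rel_ideal.zero)
  show "a - b = a + - b" by transfer (simp add: rel_cong_def rel_ideal.zero)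
  show "a * b * c = a * (b * c)" by transfer (simp add: rel_cong_def rel_ideal.zero mult.assoc)
  show "1 * a = a" by transfer (simp add: rel_cong_def rel_ideal.zero)
  show "a * 1 = a" by transfer (simp add: rel_cong_def rel_ideal.zero)
  show "(a + b) * c = a * c + b * c"
    by transfer (simp add: rel_cong_def rel_ideal.zero distrib_right)
  show "a * (b + c) = a * b + a * c"
    by transfer (simp add: rel_cong_def rel_ideal.zero distrib_left)
qed

end

definition emb :: "free_alg \<Rightarrow> qboson" where
  "emb = abs_qboson"

definition scale :: "Cq \<Rightarrow> qboson \<Rightarrow> qboson" (infixr \<open>*\<^sub>q\<close> 75) where
  "c *\<^sub>q x = emb (fconst c) * x"

definition qboson_ring :: "qboson ring" where
  "qboson_ring = \<lparr>carrier = UNIV, mult = (*), one = 1, zero = 0, add = (+)\<rparr>"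

abbreviation gA :: "idx \<Rightarrow> qboson" where "gA i \<equiv> emb (gvar (GA i))"
abbreviation gAp :: "idx \<Rightarrow> qboson" where "gAp i \<equiv> emb (gvar (GAp i))"
abbreviation gK :: "idx \<Rightarrow> qboson" where "gK i \<equiv> emb (gvar (GK i))"
abbreviation gKinv :: "idx \<Rightarrow> qboson" where "gKinv i \<equiv> emb (gvar (GKinv i))"

definition dpow :: "qboson \<Rightarrow> nat \<Rightarrow> qboson" where
  "dpow x n = inverse (qfact n) *\<^sub>q x ^ n"

section \<open>The two \<open>\<complex>[q, q\<^sup>-\<^sup>1]\<close>-subalgebras\<close>

definition laurent_subalgebra :: "qboson set \<Rightarrow> bool" where
  "laurent_subalgebra S \<longleftrightarrow>
     1 \<in> S \<and> (\<forall>x\<in>S. \<forall>y\<in>S. x + y \<in> S) \<and> (\<forall>x\<in>S. \<forall>y\<in>S. x * y \<in> S) \<and>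
     (\<forall>c\<in>laurent. \<forall>x\<in>S. c *\<^sub>q x \<in> S)"

definition Bres1 :: "qboson set" where
  "Bres1 = laurent_subalgebra hull
     ({gA i | i. True} \<union> {dpow (gAp i) r | i r. r \<ge> 1} \<union>
      {gK i | i. True} \<union> {gKinv i | i. True} \<union> {1})"

definition Bres2 :: "qboson set" where
  "Bres2 = laurent_subalgebra hull
     ({gA I1} \<union> {dpow (gAp I1) r | r. r \<ge> 1} \<union> {dpow (gA I2) r | r. r \<ge> 1} \<union> {gAp I2} \<union>
      {gK I1, gKinv I1, gK I2, gKinv I2} \<union> {1})"

section \<open>Extension of scalars from \<open>\<complex>[q, q\<^sup>-\<^sup>1]\<close> to \<open>\<complex>(q)\<close>\<close>

text \<open>
  \<open>S \<otimes> \<complex>(q)\<close> over \<open>\<complex>[q, q\<^sup>-\<^sup>1]\<close> is the free abelian group on symbols \<open>Sym b f\<close> with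
  \<open>b \<in> S\<close>, \<open>f \<in> \<complex>(q)\<close>, modulo the subgroup generated by the bilinearity and balancing relators.
  Symbols carry the componentwise product \<open>(b, f) (b', f') = (b b', f f')\<close>, written additively as
  above, so that the convolution product of \<open>sym \<Rightarrow>\<^sub>0 int\<close> induces the product
  \<open>(b \<otimes> f) (b' \<otimes> f') = b b' \<otimes> f f'\<close>.
\<close>

datatype sym = Sym qboson Cq

instantiation sym :: monoid_add
begin

definition zero_sym :: sym where
  "0 = Sym 1 1"

fun plus_sym :: "sym \<Rightarrow> sym \<Rightarrow> sym" where
  "Sym b f + Sym b' f' = Sym (b * b') (f * f')"

instance
proof
  fix x y z :: sym
  show "x + y + z = x + (y + z)" by (cases x; cases y; cases z) (simp add: mult.assoc)
  show "0 + x = x" by (cases x) (simp add: zero_sym_def)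
  show "x + 0 = x" by (cases x) (simp add: zero_sym_def)
qed

end

abbreviation symb :: "qboson \<Rightarrow> Cq \<Rightarrow> sym \<Rightarrow>\<^sub>0 int" where
  "symb b f \<equiv> Poly_Mapping.single (Sym b f) 1"

definition tensor_pre :: "qboson set \<Rightarrow> (sym \<Rightarrow>\<^sub>0 int) ring" where
  "tensor_pre S =
     \<lparr>carrier = {p. Poly_Mapping.keys p \<subseteq> {Sym b f | b f. b \<in> S}},
      mult = (*), one = 1, zero = 0, add = (+)\<rparr>"

definition tensor_relators :: "qboson set \<Rightarrow> (sym \<Rightarrow>\<^sub>0 int) set" where
  "tensor_relators S =
     {symb (b + b') f - symb b f - symb b' f | b b' f. b \<in> S \<and> b' \<in> S} \<union>
     {symb b (f + f') - symb b f - symb b f' | b f f'. b \<in> S} \<union>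
     {symb (c *\<^sub>q b) f - symb b (c * f) | c b f. c \<in> laurent \<and> b \<in> S}"

definition tensor_null :: "qboson set \<Rightarrow> (sym \<Rightarrow>\<^sub>0 int) set" where
  "tensor_null S = generate (add_monoid (tensor_pre S)) (tensor_relators S)"

definition tensor :: "qboson set \<Rightarrow> (sym \<Rightarrow>\<^sub>0 int) set ring" where
  "tensor S = tensor_pre S Quot tensor_null S"

definition pure_tensor :: "qboson set \<Rightarrow> qboson \<Rightarrow> Cq \<Rightarrow> (sym \<Rightarrow>\<^sub>0 int) set" where
  "pure_tensor S b f = tensor_null S +>\<^bsub>tensor_pre S\<^esub> symb b f"

text \<open>The \<open>\<int>\<close>-linear extension of \<open>(b, f) \<mapsto> f b\<close>, and the map it induces on the quotient.\<close>

fun sym_val :: "sym \<Rightarrow> qboson" where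
  "sym_val (Sym b f) = f *\<^sub>q b"

definition mult_pre :: "(sym \<Rightarrow>\<^sub>0 int) \<Rightarrow> qboson" where
  "mult_pre p = (\<Sum>s\<in>Poly_Mapping.keys p. of_int (Poly_Mapping.lookup p s) *\<^sub>q sym_val s)"

definition mult_map :: "(sym \<Rightarrow>\<^sub>0 int) set \<Rightarrow> qboson" where
  "mult_map t = the_elem (mult_pre ` t)"

text \<open>
  \<open>mult_map\<close> is an isomorphism of \<open>\<complex>(q)\<close>-algebras with \<open>b \<otimes> f \<mapsto> f b\<close>; \<open>\<complex>(q)\<close> acts on the
  tensor product by \<open>c t = (1 \<otimes> c) t\<close>.
\<close>

definition integral_form :: "qboson set \<Rightarrow> bool" where
  "integral_form S \<longleftrightarrow>
     laurent_subalgebra S \<and>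
     Ring.ring (tensor S) \<and>
     mult_map \<in> ring_iso (tensor S) qboson_ring \<and>
     (\<forall>b\<in>S. \<forall>f. mult_map (pure_tensor S b f) = f *\<^sub>q b) \<and>
     (\<forall>c. \<forall>t\<in>carrier (tensor S).
        mult_map (pure_tensor S 1 c \<otimes>\<^bsub>tensor S\<^esub> t) = c *\<^sub>q mult_map t)"

end

theory Submission
  imports Defs
begin

text \<open>
  The ring \<open>\<complex>[q, q\<^sup>-\<^sup>1]\<close> is an integral domain with fraction field \<open>\<complex>(q)\<close>, and any
  subalgebra \<open>S\<close> sits inside a \<open>\<complex>(q)\<close>-vector space. For such an \<open>S\<close> the multiplication map
  \<open>S \<otimes> \<complex>(q) \<rightarrow> B\<close> is automatically injective: any finite sum of pure tensors can be brought to a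
  common denominator and so is a single \<open>b \<otimes> 1/d\<close> (\<open>common_denominator\<close>), and \<open>b/d = 0\<close> forces
  \<open>b = 0\<close>. Hence the multiplication map on formal sums, which is a ring homomorphism because the
  scalars are central, has exactly the tensor relations as its kernel (\<open>kernel_eq_null\<close>), and the
  isomorphism theorem for rings gives everything except surjectivity.

  Surjectivity asks that every element of \<open>B\<close> have a nonzero multiple in \<open>S\<close>. The elements with
  this property form a \<open>\<complex>(q)\<close>-subalgebra, so it suffices that \<open>S\<close> contain the generators
  \<open>a\<^sub>i, a\<^sub>i\<^sup>+, K\<^sub>i, K\<^sub>i\<^sup>-\<^sup>1\<close> (\<open>clear_denominators\<close>). Both subalgebras do, since the first divided power of
  \<open>x\<close> is \<open>x\<close>.
\<close>

section \<open>Scalars\<close>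

lemma fconst_add: "fconst (c + d) = fconst c + fconst d"
  by (simp add: fconst_def single_add)

lemma fconst_mult: "fconst (c * d) = fconst c * fconst d"
  by (simp add: fconst_def mult_single)

lemma fconst_1: "fconst 1 = 1"
  by (simp add: fconst_def)

lemma poly_mapping_induct_add [case_names single add]:
  fixes p :: "'a \<Rightarrow>\<^sub>0 'b::comm_monoid_add"
  assumes single: "\<And>k v. P (Poly_Mapping.single k v)"
    and add: "\<And>p p'. P p \<Longrightarrow> P p' \<Longrightarrow> P (p + p')"
  shows "P p"
proof (induction p rule: update_induct)
  case const
  show ?case using single[of undefined 0] by simp
next
  case (update f a b)
  have "Poly_Mapping.update a b f = f + Poly_Mapping.single a b"
    using update.hyps(1)
    by (intro poly_mapping_eqI) (auto simp: lookup_update lookup_add lookup_single not_in_keys_iff_lookup_eq_zero when_def)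
  then show ?case using add[OF update.IH single] by simp
qed

lemma fconst_central: "fconst c * p = p * fconst c"
  by (induction p rule: poly_mapping_induct_add)
    (simp_all add: fconst_def mult_single mult.commute algebra_simps)

lemma emb_add: "emb (x + y) = emb x + emb y"
  by (simp add: emb_def plus_qboson.abs_eq)

lemma emb_mult: "emb (x * y) = emb x * emb y"
  by (simp add: emb_def times_qboson.abs_eq)

lemma emb_1: "emb 1 = 1"
  by (simp add: emb_def one_qboson.abs_eq)

lemma emb_surj: "\<exists>p. x = emb p"
  unfolding emb_def using Quotient_abs_rep[OF Quotient_qboson, of x] by metis

lemma scale_add_right: "c *\<^sub>q (x + y) = c *\<^sub>q x + c *\<^sub>q y"
  by (simp add: scale_def distrib_left)

lemma scale_add_left: "(c + d) *\<^sub>q x = c *\<^sub>q x + d *\<^sub>q x"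
  by (simp add: scale_def fconst_add emb_add distrib_right)

lemma scale_scale: "c *\<^sub>q d *\<^sub>q x = (c * d) *\<^sub>q x"
  by (simp add: scale_def fconst_mult emb_mult mult.assoc)

lemma scale_one: "1 *\<^sub>q x = x"
  by (simp add: scale_def fconst_1 emb_1)

lemma scale_zero_right: "c *\<^sub>q 0 = 0"
  by (simp add: scale_def)

lemma scale_zero_left: "0 *\<^sub>q x = 0"
  using scale_add_left[of 0 0 x] by simp

lemma scale_minus_left: "(- c) *\<^sub>q x = - (c *\<^sub>q x)"
  using scale_add_left[of "- c" c x] by (simp add: scale_zero_left eq_neg_iff_add_eq_0)

text \<open>
  Scalars are central in the free algebra, so they may be moved past \<open>x\<close>; this makes \<open>b \<otimes> f \<mapsto> f b\<close>
  multiplicative.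
\<close>
lemma scale_mult: "(c *\<^sub>q x) * (d *\<^sub>q y) = (c * d) *\<^sub>q (x * y)"
proof -
  obtain p where p: "x = emb p" using emb_surj by blast
  have "x * emb (fconst d) = emb (fconst d) * x"
    by (simp add: p fconst_central flip: emb_mult)
  then show ?thesis
    by (simp add: scale_def fconst_mult emb_mult) (metis mult.assoc)
qed

lemma scale_eq_0: "c *\<^sub>q x = 0 \<Longrightarrow> c \<noteq> 0 \<Longrightarrow> x = 0"
  by (metis left_inverse scale_one scale_scale scale_zero_right)

lemma qq_nonzero: "qq \<noteq> 0"
  by (simp add: qq_def)

text \<open>
  The point is \<open>q - q\<^sup>-\<^sup>1 \<noteq> 0\<close>; otherwise \<open>[1]\<^sub>q\<close> would be \<open>0/0 = 0\<close>.
\<close>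
lemma qint_1: "qint (Suc 0) = 1"
proof -
  have "qq * qq \<noteq> 1"
  proof
    assume "qq * qq = 1"
    then have "to_fract ([:0, 1:] * [:0, 1:] :: complex poly) = to_fract 1"
      by (simp only: qq_def to_fract_mult to_fract_1)
    then show False by (simp only: to_fract_eq_iff) (simp add: one_pCons)
  qed
  then have "qq - inverse qq \<noteq> 0"
    using qq_nonzero by (simp add: field_simps)
  then show ?thesis by (simp add: qint_def)
qed

lemma dpow_1: "dpow x 1 = x"
  by (simp add: dpow_def qfact_def qint_1 scale_one)

lemma laurent_to_fract: "to_fract p \<in> laurent"
  unfolding laurent_def by (intro CollectI exI[of _ p] exI[of _ 0]) simp

lemma laurent_mult: "c \<in> laurent \<Longrightarrow> d \<in> laurent \<Longrightarrow> c * d \<in> laurent"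
  unfolding laurent_def
  by clarify (metis power_add times_divide_times_eq to_fract_mult)

lemma laurent_denominator:
  obtains d where "d \<in> laurent" "d \<noteq> 0" "d * c \<in> laurent"
proof (cases c)
  case (Fract a b)
  then have "to_fract b * c = to_fract a"
    by (simp add: Fract_conv_to_fract)
  then show thesis
    using that[of "to_fract b"] Fract laurent_to_fract by simp
qed

section \<open>Subalgebras\<close>

lemma laurent_subalgebra_hull: "laurent_subalgebra (laurent_subalgebra hull X)"
  by (rule hull_in) (simp add: laurent_subalgebra_def)

context
  fixes S assumes S: "laurent_subalgebra S"
begin

lemma sub_1: "1 \<in> S"
  and sub_add: "x \<in> S \<Longrightarrow> y \<in> S \<Longrightarrow> x + y \<in> S"
  and sub_mult: "x \<in> S \<Longrightarrow> y \<in> S \<Longrightarrow> x * y \<in> S"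
  and sub_scale: "c \<in> laurent \<Longrightarrow> x \<in> S \<Longrightarrow> c *\<^sub>q x \<in> S"
  using S by (auto simp: laurent_subalgebra_def)

lemma sub_0: "0 \<in> S"
  using sub_scale[OF laurent_to_fract[of 0] sub_1] by (simp add: scale_zero_left)

lemma sub_uminus: "x \<in> S \<Longrightarrow> - x \<in> S"
  using sub_scale[OF laurent_to_fract[of "- 1"], of x] by (simp add: scale_minus_left scale_one)

text \<open>
  The elements some nonzero Laurent multiple of which lies in \<open>S\<close> are closed under sums and
  products (multiply the two denominators) and under arbitrary scalars of \<open>\<complex>(q)\<close> (absorb the denominator of
  the scalar). They include every word in the generators, hence everything.
\<close>
lemma clear_denominators:
  assumes gens: "\<And>g. emb (gvar g) \<in> S"
  shows "\<exists>d b. b \<in> S \<and> x = d *\<^sub>q b"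
proof -
  define T where "T = {x. \<exists>d\<in>laurent. d \<noteq> 0 \<and> d *\<^sub>q x \<in> S}"
  have scale: "c *\<^sub>q x \<in> T" if xT: "x \<in> T" for c x
  proof -
    obtain d where d: "d \<in> laurent" "d \<noteq> 0" "d *\<^sub>q x \<in> S" using xT unfolding T_def by blast
    obtain e where e: "e \<in> laurent" "e \<noteq> 0" "e * c \<in> laurent" by (rule laurent_denominator)
    have "(e * d) *\<^sub>q c *\<^sub>q x = (e * c) *\<^sub>q d *\<^sub>q x" by (simp add: scale_scale ac_simps)
    also have "\<dots> \<in> S" using d e sub_scale by blast
    finally show ?thesis
      using d e laurent_mult unfolding T_def by (intro CollectI bexI[of _ "e * d"]) simp_all
  qed
  have mult: "x * y \<in> T" if xy: "x \<in> T" "y \<in> T" for x y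
  proof -
    obtain d e where "d \<in> laurent" "d \<noteq> 0" "d *\<^sub>q x \<in> S" "e \<in> laurent" "e \<noteq> 0" "e *\<^sub>q y \<in> S"
      using xy unfolding T_def by blast
    then show ?thesis
      using sub_mult[of "d *\<^sub>q x" "e *\<^sub>q y"] laurent_mult unfolding T_def
      by (intro CollectI bexI[of _ "d * e"]) (simp_all add: scale_mult)
  qed
  have T_add: "x + y \<in> T" if xy: "x \<in> T" "y \<in> T" for x y
  proof -
    obtain d e where de: "d \<in> laurent" "d \<noteq> 0" "d *\<^sub>q x \<in> S" "e \<in> laurent" "e \<noteq> 0" "e *\<^sub>q y \<in> S"
      using xy unfolding T_def by blast
    have "(d * e) *\<^sub>q (x + y) = e *\<^sub>q d *\<^sub>q x + d *\<^sub>q e *\<^sub>q y"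
      by (simp add: scale_add_right scale_scale mult.commute)
    also have "\<dots> \<in> S" using de sub_add sub_scale by blast
    finally show ?thesis
      using de laurent_mult unfolding T_def by (intro CollectI bexI[of _ "d * e"]) simp_all
  qed
  have ST: "x \<in> T" if "x \<in> S" for x
    unfolding T_def using that laurent_to_fract[of 1]
    by (intro CollectI bexI[of _ 1]) (simp_all add: scale_one)
  have word: "emb (Poly_Mapping.single (Word w) 1) \<in> T" for w
  proof (induction w)
    case Nil
    then show ?case using ST[OF sub_1] by (simp add: emb_1 flip: zero_word_def)
  next
    case (Cons g w)
    have "Poly_Mapping.single (Word (g # w)) 1 = gvar g * Poly_Mapping.single (Word w) (1::Cq)"
      by (simp add: gvar_def mult_single)
    then show ?case using mult[OF ST[OF gens] Cons.IH] by (simp add: emb_mult)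
  qed
  have "emb p \<in> T" for p
  proof (induction p rule: poly_mapping_induct_add)
    case (single k v)
    obtain w where "k = Word w" by (cases k)
    moreover have "Poly_Mapping.single k v = fconst v * Poly_Mapping.single k 1"
      by (simp add: fconst_def mult_single)
    ultimately show ?case
      using scale[OF word, of v w] by (simp add: scale_def emb_mult)
  next
    case (add p p')
    then show ?case using T_add by (simp add: emb_add)
  qed
  then have "x \<in> T" using emb_surj[of x] by blast
  then obtain d where "d \<noteq> 0" "d *\<^sub>q x \<in> S" by (auto simp: T_def)
  then show ?thesis
    by (intro exI[of _ "inverse d"] exI[of _ "d *\<^sub>q x"]) (simp add: scale_scale scale_one)
qed

end

section \<open>The multiplication map on formal sums\<close>

text \<open>
  The support of a sum may be smaller than the union of the supports; summing over a fixed larger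
  set makes additivity visible.
\<close>
lemma mult_pre_superset:
  assumes "finite A" "Poly_Mapping.keys p \<subseteq> A"
  shows "mult_pre p = (\<Sum>s\<in>A. of_int (Poly_Mapping.lookup p s) *\<^sub>q sym_val s)"
  unfolding mult_pre_def using assms
  by (intro sum.mono_neutral_left) (auto simp: not_in_keys_iff_lookup_eq_zero scale_zero_left)

lemma mult_pre_0: "mult_pre 0 = 0"
  by (simp add: mult_pre_def)

lemma mult_pre_add: "mult_pre (p + p') = mult_pre p + mult_pre p'"
proof -
  let ?A = "Poly_Mapping.keys p \<union> Poly_Mapping.keys p'"
  have "Poly_Mapping.keys (p + p') \<subseteq> ?A" by (rule keys_add)
  then show ?thesis
    by (simp add: mult_pre_superset[of ?A] lookup_add scale_add_left sum.distrib)
qed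

lemma mult_pre_diff: "mult_pre (p - p') = mult_pre p - mult_pre p'"
  using mult_pre_add[of "p - p'" p'] by (simp add: algebra_simps)

lemma mult_pre_symb: "mult_pre (symb b f) = f *\<^sub>q b"
  by (simp add: mult_pre_def scale_one)

lemma mult_pre_mult: "mult_pre (p * p') = mult_pre p * mult_pre p'"
  using subset_UNIV[of "Poly_Mapping.keys p"]
proof (induction p rule: frag_induction)
  case (one s)
  show ?case
    using subset_UNIV[of "Poly_Mapping.keys p'"]
  proof (induction p' rule: frag_induction)
    case (one s')
    show ?case
      by (cases s; cases s') (simp add: mult_single mult_pre_symb scale_mult)
  qed (simp_all add: mult_pre_0 mult_pre_diff right_diff_distrib)
qed (simp_all add: mult_pre_0 mult_pre_diff left_diff_distrib)

lemma ring_qboson_ring: "Ring.ring qboson_ring"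
proof (rule ringI)
  show "abelian_group qboson_ring"
    by (rule abelian_groupI) (auto simp: qboson_ring_def algebra_simps intro: exI[of _ "- x" for x] left_minus)
  show "Group.monoid qboson_ring"
    by (rule monoidI) (auto simp: qboson_ring_def mult.assoc)
qed (auto simp: qboson_ring_def algebra_simps)

section \<open>The kernel consists of the tensor relations\<close>

context
  fixes S assumes S: "laurent_subalgebra S"
begin

lemma tensor_pre_simps:
  "p \<in> carrier (tensor_pre S) \<longleftrightarrow> Poly_Mapping.keys p \<subseteq> {Sym b f | b f. b \<in> S}"
  "mult (tensor_pre S) = (*)" "one (tensor_pre S) = 1" "zero (tensor_pre S) = 0"
  "add (tensor_pre S) = (+)"
  by (simp_all add: tensor_pre_def)

lemma symb_carrier: "b \<in> S \<Longrightarrow> symb b f \<in> carrier (tensor_pre S)"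
  by (simp add: tensor_pre_simps)

lemma carrier_add:
  "p \<in> carrier (tensor_pre S) \<Longrightarrow> p' \<in> carrier (tensor_pre S) \<Longrightarrow> p + p' \<in> carrier (tensor_pre S)"
  unfolding tensor_pre_simps using keys_add[of p p'] by blast

lemma carrier_uminus: "p \<in> carrier (tensor_pre S) \<Longrightarrow> - p \<in> carrier (tensor_pre S)"
  by (simp add: tensor_pre_simps)

lemma carrier_diff:
  "p \<in> carrier (tensor_pre S) \<Longrightarrow> p' \<in> carrier (tensor_pre S) \<Longrightarrow> p - p' \<in> carrier (tensor_pre S)"
  using carrier_add[OF _ carrier_uminus, of p p'] by simp

lemma carrier_mult:
  assumes "p \<in> carrier (tensor_pre S)" "p' \<in> carrier (tensor_pre S)"
  shows "p * p' \<in> carrier (tensor_pre S)"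
  unfolding tensor_pre_simps
proof
  fix s assume "s \<in> Poly_Mapping.keys (p * p')"
  then obtain a a' where "s = a + a'" "a \<in> Poly_Mapping.keys p" "a' \<in> Poly_Mapping.keys p'"
    using keys_mult[of p p'] by blast
  moreover from this obtain b f b' f' where "a = Sym b f" "b \<in> S" "a' = Sym b' f'" "b' \<in> S"
    using assms unfolding tensor_pre_simps by blast
  ultimately show "s \<in> {Sym b f | b f. b \<in> S}"
    using sub_mult[OF S] by simp
qed

lemma carrier_1: "1 \<in> carrier (tensor_pre S)"
proof -
  have "(1 :: sym \<Rightarrow>\<^sub>0 int) = symb 1 1" by (simp flip: zero_sym_def)
  then show ?thesis using symb_carrier[OF sub_1[OF S]] by metis
qed

lemma ring_tensor_pre: "Ring.ring (tensor_pre S)"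
proof (rule ringI)
  show "abelian_group (tensor_pre S)"
  proof (rule abelian_groupI)
    show "\<exists>y\<in>carrier (tensor_pre S). y \<oplus>\<^bsub>tensor_pre S\<^esub> x = \<zero>\<^bsub>tensor_pre S\<^esub>"
      if "x \<in> carrier (tensor_pre S)" for x
      using carrier_uminus[OF that] by (intro bexI[of _ "- x"]) (simp_all add: tensor_pre_simps(2-))
    show "\<zero>\<^bsub>tensor_pre S\<^esub> \<in> carrier (tensor_pre S)" by (simp add: tensor_pre_simps)
  qed (auto simp: tensor_pre_simps(2-) carrier_add ac_simps)
  show "Group.monoid (tensor_pre S)"
    by (rule monoidI) (auto simp: tensor_pre_simps(2-) carrier_mult carrier_1 ac_simps)
qed (auto simp: tensor_pre_simps(2-) algebra_simps)

lemma mult_pre_ring_hom: "ring_hom_ring (tensor_pre S) qboson_ring mult_pre"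
proof (rule ring_hom_ringI[OF ring_tensor_pre ring_qboson_ring])
  have "(1 :: sym \<Rightarrow>\<^sub>0 int) = symb 1 1" by (simp flip: zero_sym_def)
  then have "mult_pre 1 = 1" by (metis mult_pre_symb scale_one)
  then show "mult_pre \<one>\<^bsub>tensor_pre S\<^esub> = \<one>\<^bsub>qboson_ring\<^esub>"
    by (simp add: tensor_pre_simps qboson_ring_def)
qed (simp_all add: tensor_pre_simps(2-) qboson_ring_def mult_pre_add mult_pre_mult)

lemma mem_kernel:
  "p \<in> a_kernel (tensor_pre S) qboson_ring mult_pre \<longleftrightarrow>
    p \<in> carrier (tensor_pre S) \<and> mult_pre p = 0"
  unfolding a_kernel_def' by (simp only: mem_Collect_eq) (simp add: qboson_ring_def)

lemma relators_kernel:
  "tensor_relators S \<subseteq> a_kernel (tensor_pre S) qboson_ring mult_pre"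
proof
  fix r assume r: "r \<in> tensor_relators S"
  have "r \<in> carrier (tensor_pre S)"
    using r unfolding tensor_relators_def
    by (auto intro!: carrier_diff symb_carrier sub_add[OF S] sub_scale[OF S])
  moreover have "mult_pre r = 0"
    using r unfolding tensor_relators_def
    by (auto simp: mult_pre_diff mult_pre_symb scale_add_right scale_add_left scale_scale mult.commute)
  ultimately show "r \<in> a_kernel (tensor_pre S) qboson_ring mult_pre"
    by (simp only: mem_kernel)
qed

lemma null_subgroup: "subgroup (tensor_null S) (add_monoid (tensor_pre S))"
proof -
  interpret Ring.ring "tensor_pre S" by (rule ring_tensor_pre)
  show ?thesis
    unfolding tensor_null_def using relators_kernel
    by (intro add.generate_is_subgroup) (auto simp: mem_kernel)
qed

lemma null_add: "p \<in> tensor_null S \<Longrightarrow> p' \<in> tensor_null S \<Longrightarrow> p + p' \<in> tensor_null S"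
  using subgroup.m_closed[OF null_subgroup] by (simp add: tensor_pre_simps)

lemma null_uminus: "p \<in> tensor_null S \<Longrightarrow> - p \<in> tensor_null S"
proof -
  interpret Ring.ring "tensor_pre S" by (rule ring_tensor_pre)
  assume p: "p \<in> tensor_null S"
  then have c: "p \<in> carrier (tensor_pre S)"
    using subgroup.subset[OF null_subgroup] by auto
  have "\<ominus>\<^bsub>tensor_pre S\<^esub> p = - p"
    using minus_equality[of "- p" p] carrier_uminus[OF c] c by (simp add: tensor_pre_simps(2-))
  then show ?thesis
    using subgroup.m_inv_closed[OF null_subgroup p] by (simp add: a_inv_def)
qed

lemma null_diff: "p \<in> tensor_null S \<Longrightarrow> p' \<in> tensor_null S \<Longrightarrow> p - p' \<in> tensor_null S"
  using null_add[OF _ null_uminus, of p p'] by simp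

lemma null_relators:
  "b \<in> S \<Longrightarrow> b' \<in> S \<Longrightarrow> symb (b + b') f - symb b f - symb b' f \<in> tensor_null S"
  "c \<in> laurent \<Longrightarrow> b \<in> S \<Longrightarrow> symb (c *\<^sub>q b) f - symb b (c * f) \<in> tensor_null S"
  unfolding tensor_null_def tensor_relators_def by (intro generate.incl; blast)+

text \<open>
  The relator for \<open>0 + 0\<close> is the negative of this symbol.
\<close>
lemma symb_0_null: "symb 0 f \<in> tensor_null S"
  using null_uminus[OF null_relators(1)[OF sub_0[OF S] sub_0[OF S], of f]] by simp

lemma symb_diff_null:
  assumes "b \<in> S" "b' \<in> S"
  shows "(symb b f - symb b' f) - symb (b - b') f \<in> tensor_null S"
  using null_relators(1)[of "b - b'" b' f] sub_add[OF S assms(1) sub_uminus[OF S assms(2)]] assms(2)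
  by (simp add: algebra_simps)

text \<open>
  The balancing relation gives \<open>b \<otimes> f = (d f) b \<otimes> 1/d\<close> when \<open>d f\<close> is a Laurent polynomial, and
  \<open>b \<otimes> 1/d = d' b \<otimes> 1/(d d')\<close> puts two such tensors over one denominator, where they can be
  subtracted. Integer combinations are built from symbols by subtraction alone, which drives the
  induction.
\<close>
lemma common_denominator:
  assumes "p \<in> carrier (tensor_pre S)"
  shows "\<exists>b\<in>S. \<exists>d\<in>laurent. d \<noteq> 0 \<and> p - symb b (inverse d) \<in> tensor_null S"
  using assms[unfolded tensor_pre_simps]
proof (induction p rule: frag_induction)
  case zero
  have "0 - symb 0 (inverse 1) \<in> tensor_null S" using null_uminus[OF symb_0_null] by simp
  then show ?case using sub_0[OF S] laurent_to_fract[of 1] by (metis to_fract_1 zero_neq_one)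
next
  case (one s)
  then obtain b f where s: "s = Sym b f" "b \<in> S" by blast
  obtain d where d: "d \<in> laurent" "d \<noteq> 0" "d * f \<in> laurent" by (rule laurent_denominator)
  have "symb ((d * f) *\<^sub>q b) (inverse d) - symb b f \<in> tensor_null S"
    using null_relators(2)[OF d(3) s(2), of "inverse d"] d(2) by (simp add: field_simps)
  from null_uminus[OF this] show ?case
    using s d sub_scale[OF S d(3) s(2)] by auto
next
  case (diff p p')
  then obtain b d b' d' where
    b: "b \<in> S" "d \<in> laurent" "d \<noteq> 0" "p - symb b (inverse d) \<in> tensor_null S" and
    b': "b' \<in> S" "d' \<in> laurent" "d' \<noteq> 0" "p' - symb b' (inverse d') \<in> tensor_null S"
    by blast
  let ?f = "inverse (d * d')" and ?c = "d' *\<^sub>q b" and ?c' = "d *\<^sub>q b'"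
  have c: "?c \<in> S" "?c' \<in> S" using b b' sub_scale[OF S] by auto
  have 1: "symb ?c ?f - symb b (inverse d) \<in> tensor_null S"
    using null_relators(2)[OF b'(2) b(1), of ?f] b(3) b'(3) by (simp add: field_simps)
  have 2: "symb ?c' ?f - symb b' (inverse d') \<in> tensor_null S"
    using null_relators(2)[OF b(2) b'(1), of ?f] b(3) b'(3) by (simp add: field_simps)
  have "(p - p') - symb (?c - ?c') ?f =
      ((p - symb b (inverse d)) - (p' - symb b' (inverse d'))) -
      ((symb ?c ?f - symb b (inverse d)) - (symb ?c' ?f - symb b' (inverse d'))) +
      ((symb ?c ?f - symb ?c' ?f) - symb (?c - ?c') ?f)"
    by (simp add: algebra_simps)
  also have "\<dots> \<in> tensor_null S"
    by (intro null_add null_diff b b' 1 2 symb_diff_null c)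
  finally show ?case
    using sub_add[OF S c(1) sub_uminus[OF S c(2)]] laurent_mult[OF b(2) b'(2)] b(3) b'(3)
    by (intro bexI[of _ "?c - ?c'"] bexI[of _ "d * d'"]) simp_all
qed

text \<open>
  Torsion-freeness enters here: modulo the relations an element of the kernel is some \<open>b \<otimes> 1/d\<close>
  with \<open>b/d = 0\<close>, so \<open>b = 0\<close>.
\<close>
lemma kernel_eq_null: "a_kernel (tensor_pre S) qboson_ring mult_pre = tensor_null S"
proof
  interpret ring_hom_ring "tensor_pre S" qboson_ring mult_pre by (rule mult_pre_ring_hom)
  show le: "tensor_null S \<subseteq> a_kernel (tensor_pre S) qboson_ring mult_pre"
    unfolding tensor_null_def
    by (intro R.add.generate_subgroup_incl[OF relators_kernel]
        additive_subgroup.a_subgroup[OF additive_subgroup_a_kernel])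
  show "a_kernel (tensor_pre S) qboson_ring mult_pre \<subseteq> tensor_null S"
  proof
    fix p assume "p \<in> a_kernel (tensor_pre S) qboson_ring mult_pre"
    then have p: "p \<in> carrier (tensor_pre S)" "mult_pre p = 0"
      by (simp_all only: mem_kernel)
    obtain b d where b: "d \<noteq> 0" "p - symb b (inverse d) \<in> tensor_null S"
      using common_denominator[OF p(1)] by blast
    have "mult_pre (p - symb b (inverse d)) = 0"
      using subsetD[OF le b(2)] by (simp only: mem_kernel)
    then have "b = 0"
      using p(2) b(1) scale_eq_0[of "inverse d" b] by (simp add: mult_pre_diff mult_pre_symb)
    then show "p \<in> tensor_null S"
      using null_add[OF b(2) symb_0_null[of "inverse d"]] by simp
  qed
qed

lemma integral_formI:
  assumes span: "\<And>x. \<exists>d b. b \<in> S \<and> x = d *\<^sub>q b"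
  shows "integral_form S"
proof -
  interpret ring_hom_ring "tensor_pre S" qboson_ring mult_pre by (rule mult_pre_ring_hom)
  have mult_map_eq: "mult_map = (\<lambda>X. the_elem (mult_pre ` X))"
    by (simp add: mult_map_def fun_eq_iff)
  have ring: "Ring.ring (tensor S)"
    using ideal.quotient_is_ring[OF kernel_is_ideal] by (simp add: tensor_def kernel_eq_null)
  have "x \<in> mult_pre ` carrier (tensor_pre S)" for x
    using span[of x] symb_carrier by (metis imageI mult_pre_symb)
  then have "mult_pre ` carrier (tensor_pre S) = carrier qboson_ring"
    by (auto simp: qboson_ring_def)
  from FactRing_iso_set[OF this] have iso: "mult_map \<in> ring_iso (tensor S) qboson_ring"
    by (simp add: tensor_def kernel_eq_null mult_map_eq)
  have pure: "mult_map (pure_tensor S b f) = f *\<^sub>q b" if "b \<in> S" for b f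
    using the_elem_simp[OF symb_carrier[OF that, of f]]
    by (simp add: mult_map_eq pure_tensor_def kernel_eq_null mult_pre_symb)
  have "pure_tensor S 1 c \<in> carrier (tensor S)" for c
    using symb_carrier[OF sub_1[OF S]]
    by (auto simp: pure_tensor_def tensor_def FactRing_def A_RCOSETS_def')
  then have "mult_map (pure_tensor S 1 c \<otimes>\<^bsub>tensor S\<^esub> t) = c *\<^sub>q mult_map t"
    if "t \<in> carrier (tensor S)" for c t
    using iso that ring_hom_mult[of mult_map "tensor S" qboson_ring] pure[OF sub_1[OF S]]
    by (simp add: ring_iso_def qboson_ring_def scale_def)
  then show ?thesis
    unfolding integral_form_def using S ring iso pure by blast
qed

corollary integral_formI_generators:
  assumes "\<And>g. emb (gvar g) \<in> S"
  shows "integral_form S"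
  using assms by (intro integral_formI clear_denominators[OF S])

end

section \<open>The two integral forms\<close>

lemma Bres1_generators: "emb (gvar g) \<in> Bres1"
proof -
  have "dpow (gAp i) 1 \<in> Bres1" for i
    unfolding Bres1_def by (rule hull_inc) blast
  then have Ap: "gAp i \<in> Bres1" for i by (simp only: dpow_1)
  have A: "gA i \<in> Bres1" for i unfolding Bres1_def by (rule hull_inc) blast
  have K: "gK i \<in> Bres1" for i unfolding Bres1_def by (rule hull_inc) blast
  have Kinv: "gKinv i \<in> Bres1" for i unfolding Bres1_def by (rule hull_inc) blast
  show ?thesis by (cases g) (simp_all only: A Ap K Kinv)
qed

lemma Bres2_generators: "emb (gvar g) \<in> Bres2"
proof -
  have "dpow (gAp I1) 1 \<in> Bres2" "dpow (gA I2) 1 \<in> Bres2"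
    unfolding Bres2_def by (rule hull_inc, blast)+
  then have div: "gAp I1 \<in> Bres2" "gA I2 \<in> Bres2" by (simp_all only: dpow_1)
  have "gA I1 \<in> Bres2" "gAp I2 \<in> Bres2"
    "gK I1 \<in> Bres2" "gK I2 \<in> Bres2" "gKinv I1 \<in> Bres2" "gKinv I2 \<in> Bres2"
    unfolding Bres2_def by (rule hull_inc, blast)+
  with div have "gA i \<in> Bres2" "gAp i \<in> Bres2" "gK i \<in> Bres2" "gKinv i \<in> Bres2" for i
    by (cases i; simp only:)+
  then show ?thesis by (cases g) (simp_all only:)
qed

theorem mainTheorem6:
  shows "integral_form Bres1 \<and> integral_form Bres2"
proof
  have "laurent_subalgebra Bres1" "laurent_subalgebra Bres2"
    unfolding Bres1_def Bres2_def by (rule laurent_subalgebra_hull)+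
  then show "integral_form Bres1" "integral_form Bres2"
    by (auto intro: integral_formI_generators Bres1_generators Bres2_generators)
qed

end
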